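(* Let $k$ be a positive integer and $f$ a function. (1) If every $n$-vertex directed graph admits a global $k$-FT connectivity preserver with at most $f(n,k)$ edges, then every $n$-vertex directed graph $G$ and every pair $s,t\in V(G)$ admit an $s$-$t$ $k$-FT connectivity preserver with $O(f(n,k))$ edges. (2) If every $n$-vertex directed graph and every source vertex admit a single-source $k$-FT connectivity preserver with at most $f(n,k)$ edges, then every $n$-vertex directed graph admits a global $k$-FT connectivity preserver with $O(f(n,k))$ edges. (3) If every $n$-vertex directed graph admits an all-pairs $k$-FT connectivity preserver with at most $f(n,k)$ edges, then every $n$-vertex directed graph and every source vertex admit a single-source $k$-FT connectivity preserver with $O(f(n,k))$ edges. Analogous statements (1)–(3) hold for the $k$-connectivity preserver family ($s$-$t$, global, single-source, all-pairs $k$-connectivity preservers).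
   Context: For a directed graph $G$: $\mathrm{flow}(G,s,t)$ is the maximum number of edge-disjoint $s$-to-$t$ paths; $\lambda_G(s,t)=\min(\mathrm{flow}(G,s,t),\mathrm{flow}(G,t,s))$; $\lambda^k_G(s,t)=\min(\lambda_G(s,t),k)$; $\lambda(G)=\min_{s,t}\lambda_G(s,t)$ and $\lambda^k(G)=\min(\lambda(G),k)$. Subgraphs $H$ have $V(H)=V(G)$, $E(H)\subseteq E(G)$. $k$-FT family: $H$ is an $s$-$t$ $k$-FT connectivity preserver (for given $s,t$) if $\lambda^1_{H-F}(s,t)=\lambda^1_{G-F}(s,t)$ for all $F\subseteq E(G)$ with $|F|\le k$; a global one if $\lambda^1(H-F)=\lambda^1(G-F)$ for all such $F$; a single-source one (for given $s$) if $\lambda^1_{H-F}(s,t)=\lambda^1_{G-F}(s,t)$ for all $t\in V$ and all such $F$; an all-pairs one if this holds for all $s,t\in V$ and all such $F$. $k$-connectivity family: $H$ is an $s$-$t$ $k$-connectivity preserver if $\lambda^k_H(s,t)=\lambda^k_G(s,t)$; global if $\lambda^k(H)=\lambda^k(G)$; single-source (for given $s$) if $\lambda^k_H(s,t)=\lambda^k_G(s,t)$ for all $t$; all-pairs if $\lambda^k_H(s,t)=\lambda^k_G(s,t)$ for all $s,t$. *)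

theory Defs
  imports
    "Graph_Theory.Graph_Theory"
    "HOL-Library.Extended_Nat"
    Complex_Main
begin

text \<open>Directed graphs are finite, loop-free and without parallel edges: an edge is a pair of
  vertices, and \<^locale>\<open>pair_digraph\<close> is the well-formedness condition.\<close>

definition n_vertex_digraph :: "nat \<Rightarrow> 'a pair_pre_digraph \<Rightarrow> bool" where
  "n_vertex_digraph n G \<longleftrightarrow> pair_digraph G \<and> card (pverts G) = n"

definition del_edges :: "'a pair_pre_digraph \<Rightarrow> ('a \<times> 'a) set \<Rightarrow> 'a pair_pre_digraph" where
  "del_edges G F = G\<lparr>parcs := parcs G - F\<rparr>"

definition edge_disjoint_paths ::
  "'a pair_pre_digraph \<Rightarrow> 'a \<Rightarrow> 'a \<Rightarrow> ('a \<times> 'a) awalk set \<Rightarrow> bool" where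
  "edge_disjoint_paths G s t P \<longleftrightarrow>
     (\<forall>p\<in>P. pre_digraph.apath (with_proj G) s p t) \<and>
     pairwise (\<lambda>p q. set p \<inter> set q = {}) P"

text \<open>Paths are vertex-simple, so for \<open>s = t\<close> the only path is the empty one and the flow is \<open>1\<close>
  in every graph containing \<open>s\<close>. Thus a pair with \<open>s = t\<close> never constrains a preserver.\<close>

definition flow :: "'a pair_pre_digraph \<Rightarrow> 'a \<Rightarrow> 'a \<Rightarrow> nat" where
  "flow G s t = Max {card P | P. edge_disjoint_paths G s t P}"

definition conn :: "'a pair_pre_digraph \<Rightarrow> 'a \<Rightarrow> 'a \<Rightarrow> nat" where
  "conn G s t = min (flow G s t) (flow G t s)"

definition conn_upto :: "nat \<Rightarrow> 'a pair_pre_digraph \<Rightarrow> 'a \<Rightarrow> 'a \<Rightarrow> nat" where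
  "conn_upto k G s t = min (conn G s t) k"

text \<open>The minimum ranges over pairs of distinct vertices; it is \<open>\<infinity>\<close> if there are none.\<close>

definition gconn :: "'a pair_pre_digraph \<Rightarrow> enat" where
  "gconn G = Inf {enat (conn G s t) | s t. s \<in> pverts G \<and> t \<in> pverts G \<and> s \<noteq> t}"

definition gconn_upto :: "nat \<Rightarrow> 'a pair_pre_digraph \<Rightarrow> enat" where
  "gconn_upto k G = min (gconn G) (enat k)"

definition st_ft_preserver ::
  "nat \<Rightarrow> 'a pair_pre_digraph \<Rightarrow> 'a \<Rightarrow> 'a \<Rightarrow> 'a pair_pre_digraph \<Rightarrow> bool" where
  "st_ft_preserver k G s t H \<longleftrightarrow> spanning (with_proj H) (with_proj G) \<and>
     (\<forall>F. F \<subseteq> parcs G \<and> card F \<le> k \<longrightarrow>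
        conn_upto 1 (del_edges H F) s t = conn_upto 1 (del_edges G F) s t)"

definition global_ft_preserver ::
  "nat \<Rightarrow> 'a pair_pre_digraph \<Rightarrow> 'a pair_pre_digraph \<Rightarrow> bool" where
  "global_ft_preserver k G H \<longleftrightarrow> spanning (with_proj H) (with_proj G) \<and>
     (\<forall>F. F \<subseteq> parcs G \<and> card F \<le> k \<longrightarrow>
        gconn_upto 1 (del_edges H F) = gconn_upto 1 (del_edges G F))"

definition single_source_ft_preserver ::
  "nat \<Rightarrow> 'a pair_pre_digraph \<Rightarrow> 'a \<Rightarrow> 'a pair_pre_digraph \<Rightarrow> bool" where
  "single_source_ft_preserver k G s H \<longleftrightarrow> spanning (with_proj H) (with_proj G) \<and>
     (\<forall>t\<in>pverts G. \<forall>F. F \<subseteq> parcs G \<and> card F \<le> k \<longrightarrow>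
        conn_upto 1 (del_edges H F) s t = conn_upto 1 (del_edges G F) s t)"

definition all_pairs_ft_preserver ::
  "nat \<Rightarrow> 'a pair_pre_digraph \<Rightarrow> 'a pair_pre_digraph \<Rightarrow> bool" where
  "all_pairs_ft_preserver k G H \<longleftrightarrow> spanning (with_proj H) (with_proj G) \<and>
     (\<forall>s\<in>pverts G. \<forall>t\<in>pverts G. \<forall>F. F \<subseteq> parcs G \<and> card F \<le> k \<longrightarrow>
        conn_upto 1 (del_edges H F) s t = conn_upto 1 (del_edges G F) s t)"

definition st_conn_preserver ::
  "nat \<Rightarrow> 'a pair_pre_digraph \<Rightarrow> 'a \<Rightarrow> 'a \<Rightarrow> 'a pair_pre_digraph \<Rightarrow> bool" where
  "st_conn_preserver k G s t H \<longleftrightarrow> spanning (with_proj H) (with_proj G) \<and>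
     conn_upto k H s t = conn_upto k G s t"

definition global_conn_preserver ::
  "nat \<Rightarrow> 'a pair_pre_digraph \<Rightarrow> 'a pair_pre_digraph \<Rightarrow> bool" where
  "global_conn_preserver k G H \<longleftrightarrow> spanning (with_proj H) (with_proj G) \<and>
     gconn_upto k H = gconn_upto k G"

definition single_source_conn_preserver ::
  "nat \<Rightarrow> 'a pair_pre_digraph \<Rightarrow> 'a \<Rightarrow> 'a pair_pre_digraph \<Rightarrow> bool" where
  "single_source_conn_preserver k G s H \<longleftrightarrow> spanning (with_proj H) (with_proj G) \<and>
     (\<forall>t\<in>pverts G. conn_upto k H s t = conn_upto k G s t)"

definition all_pairs_conn_preserver ::
  "nat \<Rightarrow> 'a pair_pre_digraph \<Rightarrow> 'a pair_pre_digraph \<Rightarrow> bool" where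
  "all_pairs_conn_preserver k G H \<longleftrightarrow> spanning (with_proj H) (with_proj G) \<and>
     (\<forall>s\<in>pverts G. \<forall>t\<in>pverts G. conn_upto k H s t = conn_upto k G s t)"

end

theory Submission
  imports Defs
begin

text \<open>The step from all pairs to a single source is immediate. For the step from a single source
  to global, Menger's theorem gives \<open>flow u v \<ge> min (flow u s) (flow s v)\<close>, so the
  global connectivity up to \<open>k\<close> is determined by the pairs containing the source.

  For the step from global to \<open>s\<close>-\<open>t\<close> in the fault-tolerant family, discard the arcs into \<open>s\<close> and
  out of \<open>t\<close>, which no simple path from \<open>s\<close> to \<open>t\<close> uses, and add all arcs \<open>(v, s)\<close> and \<open>(t, v)\<close>.
  After any faults among the original arcs, the new graph is strongly connected iff \<open>t\<close> is
  reachable from \<open>s\<close>. One such graph per direction gives the factor 2.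

  In the connectivity family the same step is a counting argument: a preserver of the complete
  digraph has all out-degrees at least \<open>min k (n - 1)\<close>, whereas at most that many simple paths in
  each direction are enough to preserve the connectivity from \<open>s\<close> to \<open>t\<close>.\<close>

section \<open>Simple paths as arc lists\<close>

text \<open>\<open>pcas\<close> and \<open>pawalk_verts\<close> read only the arc list, so a path
  can be moved unchanged between a digraph, its subgraphs and a residual arc set.\<close>

definition simple_path :: "'a \<Rightarrow> ('a \<times> 'a) list \<Rightarrow> 'a \<Rightarrow> bool" where
  "simple_path u p v \<longleftrightarrow> pcas u p v \<and> distinct (pawalk_verts u p)"

lemma apath_with_proj_iff:
  "pre_digraph.apath (with_proj G) u p v \<longleftrightarrow>
     u \<in> pverts G \<and> set p \<subseteq> parcs G \<and> simple_path u p v"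
  by (auto simp: pre_digraph.apath_def pre_digraph.awalk_def simple_path_def cas_with_proj_eq
      awalk_verts_with_proj_eq)

lemma simple_path_Nil [simp]: "simple_path u [] v \<longleftrightarrow> u = v"
  by (simp add: simple_path_def)

lemma simple_path_Cons [simp]:
  "simple_path u (e # p) v \<longleftrightarrow>
     fst e = u \<and> u \<notin> set (pawalk_verts (snd e) p) \<and> simple_path (snd e) p v"
  by (auto simp: simple_path_def)

lemma fst_in_pawalk_verts: "e \<in> set p \<Longrightarrow> fst e \<in> set (pawalk_verts u p)"
  by (induction p arbitrary: u) auto

lemma start_in_pawalk_verts: "pcas u p v \<Longrightarrow> u \<in> set (pawalk_verts u p)"
  by (cases p) auto

lemma snd_in_pawalk_verts: "pcas u p v \<Longrightarrow> e \<in> set p \<Longrightarrow> snd e \<in> set (pawalk_verts u p)"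
  by (induction p arbitrary: u) (auto simp: start_in_pawalk_verts)

lemma simple_path_distinct: "simple_path u p v \<Longrightarrow> distinct p"
  by (induction p arbitrary: u) (auto dest: fst_in_pawalk_verts)

lemma simple_path_snd_neq_start: "simple_path u p v \<Longrightarrow> e \<in> set p \<Longrightarrow> snd e \<noteq> u"
  by (cases p) (auto simp: simple_path_def dest: snd_in_pawalk_verts start_in_pawalk_verts)

lemma simple_path_fst_neq_end: "simple_path u p v \<Longrightarrow> e \<in> set p \<Longrightarrow> fst e \<noteq> v"
proof (induction p arbitrary: u)
  case (Cons a p)
  have "v \<in> set (pawalk_verts (snd a) p)"
  proof -
    have "v \<in> set (pawalk_verts x p)" if "pcas x p v" for x
      using that by (induction p arbitrary: x) auto
    then show ?thesis
      using Cons.prems by (auto simp: simple_path_def)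
  qed
  with Cons show ?case
    by auto
qed simp

lemma simple_path_suffix:
  assumes "simple_path u p v" "x \<in> set (pawalk_verts u p)"
  obtains q where "simple_path x q v" "set q \<subseteq> set p"
  using assms
proof (induction p arbitrary: u thesis)
  case (Cons a p)
  show ?case
  proof (cases "x = u")
    case True
    with Cons.prems show ?thesis
      by (intro Cons.prems(1)[of "a # p"]) auto
  next
    case False
    with Cons.prems have "x \<in> set (pawalk_verts (snd a) p)" "simple_path (snd a) p v"
      by auto
    then obtain q where "simple_path x q v" "set q \<subseteq> set p"
      using Cons.IH by blast
    then show ?thesis
      by (intro Cons.prems(1)) auto
  qed
qed auto

text \<open>Arcs are prepended one at a time; when the new start already lies on the path, the
  suffix from that vertex takes over, so the path stays simple.\<close>

lemma rtrancl_simple_path: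
  assumes "(u, v) \<in> R\<^sup>*"
  obtains p where "simple_path u p v" "set p \<subseteq> R"
  using assms
proof (induction arbitrary: thesis rule: converse_rtrancl_induct)
  case base
  show ?case by (rule base[of "[]"]) auto
next
  case (step x y)
  obtain p where p: "simple_path y p v" "set p \<subseteq> R"
    using step.IH by blast
  show ?case
  proof (cases "x \<in> set (pawalk_verts y p)")
    case True
    with p show ?thesis
      by (meson simple_path_suffix step.prems subset_trans)
  next
    case False
    with p step.hyps(1) show ?thesis
      by (intro step.prems[of "(x, y) # p"]) auto
  qed
qed

lemma pcas_rtrancl: "pcas u p v \<Longrightarrow> set p \<subseteq> R \<Longrightarrow> (u, v) \<in> R\<^sup>*"
  by (induction p arbitrary: u) (auto intro: converse_rtrancl_into_rtrancl)

lemma rtrancl_iff_simple_path: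
  "(u, v) \<in> R\<^sup>* \<longleftrightarrow> (\<exists>p. simple_path u p v \<and> set p \<subseteq> R)"
  by (meson pcas_rtrancl rtrancl_simple_path simple_path_def)

text \<open>A simple path never re-enters its start or leaves its end. Hence artificial arcs into
  \<open>s\<close> or out of \<open>t\<close> do not help in getting from \<open>s\<close> to
  \<open>t\<close>.\<close>

lemma rtrancl_avoid_ends:
  assumes "(s, t) \<in> R\<^sup>*"
  shows "(s, t) \<in> {e \<in> R. snd e \<noteq> s \<and> fst e \<noteq> t}\<^sup>*"
proof -
  obtain p where "simple_path s p t" "set p \<subseteq> R"
    using assms by (rule rtrancl_simple_path)
  then have "set p \<subseteq> {e \<in> R. snd e \<noteq> s \<and> fst e \<noteq> t}"
    using simple_path_snd_neq_start simple_path_fst_neq_end by fastforce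
  with \<open>simple_path s p t\<close> show ?thesis
    unfolding rtrancl_iff_simple_path by blast
qed

lemma pcas_crosses_cut:
  assumes "pcas u p v" "u \<in> X" "v \<notin> X"
  shows "\<exists>e\<in>set p. fst e \<in> X \<and> snd e \<notin> X"
  using assms by (induction p arbitrary: u) auto

section \<open>Menger's theorem\<close>

text \<open>A flow with unit capacities is encoded by the set of arcs that carry it; this is its
  excess at \<open>w\<close>, out-degree minus in-degree.\<close>

definition net :: "('a \<times> 'a) set \<Rightarrow> 'a \<Rightarrow> int" where
  "net A w = (\<Sum>e\<in>A. of_bool (fst e = w) - of_bool (snd e = w))"

definition cut_arcs :: "('a \<times> 'a) set \<Rightarrow> 'a set \<Rightarrow> ('a \<times> 'a) set" where
  "cut_arcs A X = {e \<in> A. fst e \<in> X \<and> snd e \<notin> X}"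

text \<open>Conservation at the inner vertices and the value \<open>m\<close> at both ends, in one
  equation.\<close>

definition is_flow :: "('a \<times> 'a) set \<Rightarrow> nat \<Rightarrow> 'a \<Rightarrow> 'a \<Rightarrow> bool" where
  "is_flow A m u v \<longleftrightarrow> (\<forall>w. net A w = int m * (of_bool (w = u) - of_bool (w = v)))"

definition residual :: "('a \<times> 'a) set \<Rightarrow> ('a \<times> 'a) set \<Rightarrow> ('a \<times> 'a) set" where
  "residual E A = (E - A) \<union> A\<inverse>"

lemma net_insert:
  "finite A \<Longrightarrow> e \<notin> A \<Longrightarrow> net (insert e A) w = net A w + of_bool (fst e = w) - of_bool (snd e = w)"
  by (simp add: net_def)

lemma net_remove:
  assumes "finite A" "e \<in> A"
  shows "net (A - {e}) w = net A w - of_bool (fst e = w) + of_bool (snd e = w)"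
  using net_insert[of "A - {e}" e w] assms by (simp add: insert_absorb)

lemma net_diff:
  assumes "finite A" "B \<subseteq> A"
  shows "net (A - B) w = net A w - net B w"
  unfolding net_def using assms by (simp add: sum_diff)

lemma net_simple_path:
  assumes "simple_path u p v"
  shows "net (set p) w = of_bool (w = u) - of_bool (w = v)"
  using assms
proof (induction p arbitrary: u)
  case Nil
  then show ?case by (simp add: net_def)
next
  case (Cons e p)
  moreover from Cons.prems have "e \<notin> set p"
    using simple_path_distinct by fastforce
  ultimately show ?case
    by (auto simp: net_insert)
qed

text \<open>Double counting: an arc contributes once for each end in \<open>X\<close>, with opposite
  signs, so arcs inside \<open>X\<close> cancel and only crossing arcs remain.\<close>

lemma sum_net:
  assumes "finite A" "finite X"
  shows "(\<Sum>w\<in>X. net A w) = int (card (cut_arcs A X)) - int (card (cut_arcs A (- X)))"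
proof -
  have "(\<Sum>w\<in>X. net A w) = (\<Sum>e\<in>A. \<Sum>w\<in>X. of_bool (fst e = w) - of_bool (snd e = w))"
    unfolding net_def by (rule sum.swap)
  also have "\<dots> = (\<Sum>e\<in>A. of_bool (fst e \<in> X) - of_bool (snd e \<in> X))"
    using assms by (intro sum.cong) (auto simp: sum_subtractf of_bool_def)
  also have "\<dots> = (\<Sum>e\<in>A. of_bool (e \<in> cut_arcs A X) - of_bool (e \<in> cut_arcs A (- X)))"
    by (intro sum.cong) (auto simp: cut_arcs_def of_bool_def)
  also have "\<dots> = int (card (A \<inter> cut_arcs A X)) - int (card (A \<inter> cut_arcs A (- X)))"
    using assms by (simp add: sum_subtractf of_bool_def sum.If_cases)
  also have "A \<inter> cut_arcs A X = cut_arcs A X"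
    by (auto simp: cut_arcs_def)
  also have "A \<inter> cut_arcs A (- X) = cut_arcs A (- X)"
    by (auto simp: cut_arcs_def)
  finally show ?thesis .
qed

lemma is_flow_across_cut:
  assumes "is_flow A m u v" "finite A" "finite X" "u \<in> X" "v \<notin> X"
  shows "int m = int (card (cut_arcs A X)) - int (card (cut_arcs A (- X)))"
proof -
  have "int m = (\<Sum>w\<in>X. int m * (of_bool (w = u) - of_bool (w = v)))"
    using assms by (simp add: sum_distrib_left[symmetric] sum_subtractf of_bool_def)
  also have "\<dots> = (\<Sum>w\<in>X. net A w)"
    using assms by (simp add: is_flow_def)
  finally show ?thesis
    using sum_net assms by metis
qed

text \<open>Each residual arc adds or removes one arc of \<open>A\<close> and so passes a unit of
  excess on to the next vertex. The sets met during the induction need not be flows, which is why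
  the statement is about \<open>net\<close>.\<close>

lemma augment_along_simple_path:
  assumes "simple_path u p v" "set p \<subseteq> residual E A" "A \<subseteq> E" "finite E"
  shows "\<exists>A'\<subseteq>E. \<forall>w. net A' w = net A w + of_bool (w = u) - of_bool (w = v)"
  using assms
proof (induction p arbitrary: u A)
  case Nil
  then show ?case by auto
next
  case (Cons e p)
  obtain y where e: "e = (u, y)"
    using Cons.prems(1) by (cases e) auto
  have p: "simple_path y p v" "u \<notin> set (pawalk_verts y p)"
    using Cons.prems(1) e by auto
  have fin: "finite A"
    using Cons.prems finite_subset by blast
  \<comment> \<open>With antiparallel arcs in \<open>E\<close>, \<open>(u, y)\<close> may be
    residual for both reasons; the forward arc is then taken. Either choice changes
    \<open>net\<close> in the same way.\<close>
  define A1 where "A1 = (if (u, y) \<in> E - A then insert (u, y) A else A - {(y, u)})"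
  have A1: "A1 \<subseteq> E"
    using Cons.prems by (auto simp: A1_def)
  have net_A1: "net A1 w = net A w + of_bool (w = u) - of_bool (w = y)" for w
  proof (cases "(u, y) \<in> E - A")
    case True
    then show ?thesis
      using fin by (auto simp: A1_def net_insert)
  next
    case False
    then have "(y, u) \<in> A"
      using Cons.prems(2) e by (auto simp: residual_def)
    with False fin show ?thesis
      by (auto simp: A1_def net_remove)
  qed
  \<comment> \<open>The remaining path avoids \<open>u\<close>, so changing an arc at \<open>u\<close> keeps it residual.\<close>
  have "set p \<subseteq> residual E A1"
  proof
    fix a assume a: "a \<in> set p"
    have "fst a \<noteq> u" "snd a \<noteq> u"
      using a p fst_in_pawalk_verts[of a p y] snd_in_pawalk_verts[of y p v a]
      by (auto simp: simple_path_def)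
    moreover have "a \<in> residual E A"
      using a Cons.prems by auto
    ultimately show "a \<in> residual E A1"
      by (cases a) (auto simp: residual_def A1_def)
  qed
  from Cons.IH[OF p(1) this A1 Cons.prems(4)] obtain A' where
    "A' \<subseteq> E" "\<forall>w. net A' w = net A1 w + of_bool (w = y) - of_bool (w = v)"
    by blast
  then show ?case
    using net_A1 by (intro exI[of _ A']) simp
qed

text \<open>Paths are peeled off one by one, each lowering the value by one. Arcs of
  \<open>A\<close> on directed cycles may be left over at the end.\<close>

lemma flow_decomposition:
  assumes "is_flow A m u v" "finite A" "u \<noteq> v"
  shows "\<exists>P. finite P \<and> card P = m \<and> (\<forall>p\<in>P. simple_path u p v \<and> set p \<subseteq> A) \<and>
    pairwise (\<lambda>p q. set p \<inter> set q = {}) P"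
  using assms
proof (induction m arbitrary: A)
  case 0
  then show ?case by (intro exI[of _ "{}"]) auto
next
  case (Suc m)
  \<comment> \<open>Otherwise the vertices reachable from \<open>u\<close> form a set that no arc of
    \<open>A\<close> leaves, although \<open>Suc m\<close> units have to get out of it.\<close>
  have "v \<in> A\<^sup>* `` {u}"
  proof (rule ccontr)
    assume "v \<notin> A\<^sup>* `` {u}"
    then have "int (Suc m) = int (card (cut_arcs A (A\<^sup>* `` {u}))) - int (card (cut_arcs A (- (A\<^sup>* `` {u}))))"
      using Suc.prems by (intro is_flow_across_cut) (auto intro: finite_rtrancl_Image)
    moreover have "cut_arcs A (A\<^sup>* `` {u}) = {}"
      by (auto simp: cut_arcs_def intro: rtrancl_into_rtrancl)
    ultimately show False
      by simp
  qed
  then obtain p where p: "simple_path u p v" "set p \<subseteq> A"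
    by (auto elim: rtrancl_simple_path)
  have "is_flow (A - set p) m u v"
    using Suc.prems p by (simp add: is_flow_def net_diff net_simple_path algebra_simps)
  then obtain P where P: "finite P" "card P = m"
    "\<forall>q\<in>P. simple_path u q v \<and> set q \<subseteq> A - set p"
    "pairwise (\<lambda>p q. set p \<inter> set q = {}) P"
    using Suc.IH Suc.prems by (metis finite_Diff)
  \<comment> \<open>Since \<open>u \<noteq> v\<close>, the path \<open>p\<close> has an arc, and no
    path in \<open>P\<close> uses it; so \<open>p\<close> is new and the cardinality really
    grows.\<close>
  have "p \<noteq> []"
    using p Suc.prems by auto
  then have "p \<notin> P"
    using P(3) by (cases p) auto
  then show ?case
    using P p by (intro exI[of _ "insert p P"]) (auto simp: pairwise_insert)
qed

text \<open>The argument of Ford and Fulkerson: a flow of maximal value splits into the paths, and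
  the set reachable in its residual digraph is the matching cut.\<close>

theorem Menger:
  assumes "finite E" "u \<noteq> v"
  shows "\<exists>P X. finite P \<and> (\<forall>p\<in>P. simple_path u p v \<and> set p \<subseteq> E) \<and>
    pairwise (\<lambda>p q. set p \<inter> set q = {}) P \<and> u \<in> X \<and> v \<notin> X \<and> card P = card (cut_arcs E X)"
proof -
  \<comment> \<open>The cut around \<open>u\<close> bounds every flow value by
    \<open>card E\<close>, so there is a largest one.\<close>
  define Q where "Q m \<longleftrightarrow> (\<exists>A\<subseteq>E. is_flow A m u v)" for m
  have "Q 0"
    by (auto simp: Q_def is_flow_def net_def intro!: exI[of _ "{}"])
  moreover have "m \<le> card E" if "Q m" for m
  proof -
    obtain A where A: "A \<subseteq> E" "is_flow A m u v"
      using \<open>Q m\<close> by (auto simp: Q_def)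
    then have "int m = int (card (cut_arcs A {u})) - int (card (cut_arcs A (- {u})))"
      using assms by (intro is_flow_across_cut) (auto intro: finite_subset)
    moreover have "card (cut_arcs A {u}) \<le> card E"
      using A assms by (intro card_mono) (auto simp: cut_arcs_def)
    ultimately show ?thesis
      by linarith
  qed
  ultimately obtain m where m: "Q m" "\<And>m'. Q m' \<Longrightarrow> m' \<le> m"
    by (metis Nat.ex_has_greatest_nat)
  then obtain A where A: "A \<subseteq> E" "is_flow A m u v"
    by (auto simp: Q_def)
  have fin: "finite A"
    using A assms finite_subset by blast
  define X where "X = (residual E A)\<^sup>* `` {u}"
  have fin_X: "finite X"
    using assms fin by (simp add: X_def residual_def finite_rtrancl_Image)
  \<comment> \<open>A residual path to \<open>v\<close> would be augmenting and raise the value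
    above the maximal \<open>m\<close>.\<close>
  have "v \<notin> X"
  proof
    assume "v \<in> X"
    then obtain p where p: "simple_path u p v" "set p \<subseteq> residual E A"
      by (auto simp: X_def elim: rtrancl_simple_path)
    obtain A' where "A' \<subseteq> E" "\<forall>w. net A' w = net A w + of_bool (w = u) - of_bool (w = v)"
      using augment_along_simple_path[OF p A(1) assms(1)] by blast
    moreover from this have "is_flow A' (Suc m) u v"
      using A(2) by (simp add: is_flow_def ring_distribs)
    ultimately have "Q (Suc m)"
      by (auto simp: Q_def)
    then show False
      using m(2) by fastforce
  qed
  \<comment> \<open>Closure under residual arcs means that every arc of \<open>E\<close> leaving
    \<open>X\<close> is used and no used arc enters \<open>X\<close>; the net flow out of
    \<open>X\<close> is then the full size of the cut.\<close>
  have closed: "y \<in> X" if "x \<in> X" "(x, y) \<in> residual E A" for x y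
    using that by (auto simp: X_def intro: rtrancl_into_rtrancl)
  have "e \<in> A" if "e \<in> cut_arcs E X" for e
    using that closed[of "fst e" "snd e"] by (auto simp: cut_arcs_def residual_def)
  then have "cut_arcs A X = cut_arcs E X"
    using A(1) by (auto simp: cut_arcs_def)
  moreover have "e \<notin> cut_arcs A (- X)" for e
    using closed[of "snd e" "fst e"] by (auto simp: cut_arcs_def residual_def)
  then have "cut_arcs A (- X) = {}"
    by blast
  ultimately have "m = card (cut_arcs E X)"
    using is_flow_across_cut[OF A(2) fin fin_X _ \<open>v \<notin> X\<close>] by (simp add: X_def)
  moreover obtain P where "finite P" "card P = m" "\<forall>p\<in>P. simple_path u p v \<and> set p \<subseteq> A"
    "pairwise (\<lambda>p q. set p \<inter> set q = {}) P"
    using flow_decomposition[OF A(2) fin assms(2)] by blast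
  moreover have "u \<in> X"
    by (simp add: X_def)
  ultimately show ?thesis
    using A(1) \<open>v \<notin> X\<close> by (intro exI[of _ P] exI[of _ X]) blast
qed

section \<open>Flow and connectivity of digraphs\<close>

lemma edge_disjoint_paths_iff:
  "edge_disjoint_paths G s t P \<longleftrightarrow>
     (\<forall>p\<in>P. s \<in> pverts G \<and> set p \<subseteq> parcs G \<and> simple_path s p t) \<and>
     pairwise (\<lambda>p q. set p \<inter> set q = {}) P"
  by (simp add: edge_disjoint_paths_def apath_with_proj_iff)

lemma finite_apaths:
  assumes "pair_digraph G"
  shows "finite {p. pre_digraph.apath (with_proj G) s p t}"
proof -
  interpret pair_digraph G by fact
  show ?thesis by (rule apaths_finite)
qed

text \<open>A finite digraph has only finitely many simple paths, which makes the \<open>Max\<close>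
  in \<open>flow\<close> meaningful.\<close>

lemma finite_card_edge_disjoint_paths:
  assumes "pair_digraph G"
  shows "finite {card P | P. edge_disjoint_paths G s t P}"
proof (rule finite_subset)
  show "{card P | P. edge_disjoint_paths G s t P} \<subseteq>
      card ` Pow {p. pre_digraph.apath (with_proj G) s p t}"
    by (auto simp: edge_disjoint_paths_def)
qed (use finite_apaths[OF assms] in auto)

lemma card_le_flow:
  "pair_digraph G \<Longrightarrow> edge_disjoint_paths G s t P \<Longrightarrow> card P \<le> flow G s t"
  unfolding flow_def by (intro Max_ge finite_card_edge_disjoint_paths) auto

text \<open>Subfamilies of an edge-disjoint family are edge-disjoint, so every size up to the
  maximum occurs.\<close>

lemma le_flow_iff:
  assumes "pair_digraph G"
  shows "m \<le> flow G s t \<longleftrightarrow> (\<exists>P. edge_disjoint_paths G s t P \<and> finite P \<and> card P = m)"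
proof
  assume "m \<le> flow G s t"
  have "edge_disjoint_paths G s t {}"
    by (simp add: edge_disjoint_paths_def)
  then have "flow G s t \<in> {card P | P. edge_disjoint_paths G s t P}"
    unfolding flow_def by (intro Max_in finite_card_edge_disjoint_paths assms) auto
  then obtain P where P: "edge_disjoint_paths G s t P" "card P = flow G s t"
    by auto
  obtain P' where "P' \<subseteq> P" "card P' = m" "finite P'"
    using obtain_subset_with_card_n[of m P] P \<open>m \<le> flow G s t\<close> by metis
  moreover from this P have "edge_disjoint_paths G s t P'"
    by (auto simp: edge_disjoint_paths_def intro: pairwise_subset)
  ultimately show "\<exists>P. edge_disjoint_paths G s t P \<and> finite P \<and> card P = m"
    by blast
qed (use card_le_flow[OF assms] in auto)

lemma flow_mono:
  assumes "pair_digraph H" "pair_digraph G" "pverts H = pverts G" "parcs H \<subseteq> parcs G"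
  shows "flow H s t \<le> flow G s t"
proof -
  obtain P where "edge_disjoint_paths H s t P" "card P = flow H s t"
    using le_flow_iff[OF assms(1)] by blast
  moreover from this have "edge_disjoint_paths G s t P"
    using assms by (auto simp: edge_disjoint_paths_iff)
  ultimately show ?thesis
    using card_le_flow[OF assms(2)] by metis
qed

text \<open>Every path crosses the cut, and disjoint paths cross it in different arcs; choosing a
  crossing arc for each path is therefore injective.\<close>

lemma flow_le_cut:
  assumes "pair_digraph G" "s \<in> X" "t \<notin> X"
  shows "flow G s t \<le> card (cut_arcs (parcs G) X)"
proof -
  obtain P where P: "edge_disjoint_paths G s t P" "card P = flow G s t"
    using le_flow_iff[OF assms(1)] by blast
  have "\<forall>p\<in>P. \<exists>e. e \<in> set p \<and> e \<in> cut_arcs (parcs G) X"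
  proof
    fix p assume "p \<in> P"
    then have "set p \<subseteq> parcs G" "pcas s p t"
      using P(1) by (auto simp: edge_disjoint_paths_iff simple_path_def)
    then show "\<exists>e. e \<in> set p \<and> e \<in> cut_arcs (parcs G) X"
      using pcas_crosses_cut[of s p t X] assms(2,3) unfolding cut_arcs_def by blast
  qed
  then obtain c where c: "\<And>p. p \<in> P \<Longrightarrow> c p \<in> set p \<and> c p \<in> cut_arcs (parcs G) X"
    by metis
  have "inj_on c P"
  proof (rule inj_onI)
    fix p q assume "p \<in> P" "q \<in> P" "c p = c q"
    then show "p = q"
      using c[of p] c[of q] P(1) unfolding edge_disjoint_paths_def pairwise_def by fastforce
  qed
  moreover have "finite (cut_arcs (parcs G) X)"
    using assms(1) pair_fin_digraph.pair_finite_arcs[of G]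
    by (auto simp: cut_arcs_def pair_digraph_def)
  ultimately show ?thesis
    using P(2) c by (metis card_inj_on_le image_subsetI)
qed

text \<open>The equally large path family and cut from \<open>Menger\<close> certify each other as
  optimal.\<close>

lemma flow_eq_cut:
  assumes "pair_digraph G" "s \<in> pverts G" "s \<noteq> t"
  obtains X where "s \<in> X" "t \<notin> X" "flow G s t = card (cut_arcs (parcs G) X)"
proof -
  have "finite (parcs G)"
    using assms(1) by (simp add: pair_digraph_def pair_fin_digraph.pair_finite_arcs)
  from Menger[OF this assms(3)] obtain P X where PX:
    "\<forall>p\<in>P. simple_path s p t \<and> set p \<subseteq> parcs G" "pairwise (\<lambda>p q. set p \<inter> set q = {}) P"
    "s \<in> X" "t \<notin> X" "card P = card (cut_arcs (parcs G) X)"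
    by blast
  then have "edge_disjoint_paths G s t P"
    using assms by (simp add: edge_disjoint_paths_iff)
  then have "card (cut_arcs (parcs G) X) \<le> flow G s t"
    using card_le_flow[OF assms(1)] PX by metis
  then show ?thesis
    using that flow_le_cut[OF assms(1) PX(3,4)] PX by force
qed

text \<open>A minimum cut between \<open>u\<close> and \<open>v\<close> has \<open>s\<close> on one
  side: on the side of \<open>u\<close> it also separates \<open>s\<close> from \<open>v\<close>, on
  the other side it separates \<open>u\<close> from \<open>s\<close>.\<close>

lemma flow_triangle:
  assumes "pair_digraph G" "u \<in> pverts G" "u \<noteq> v"
  shows "min (flow G u s) (flow G s v) \<le> flow G u v"
proof -
  obtain X where X: "u \<in> X" "v \<notin> X" "flow G u v = card (cut_arcs (parcs G) X)"
    using flow_eq_cut assms by metis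
  show ?thesis
  proof (cases "s \<in> X")
    case True
    then show ?thesis
      using flow_le_cut[OF assms(1), of s X v] X by simp
  next
    case False
    then show ?thesis
      using flow_le_cut[OF assms(1), of u X s] X by simp
  qed
qed

lemma flow_pos_iff:
  assumes "pair_digraph G" "s \<in> pverts G"
  shows "1 \<le> flow G s t \<longleftrightarrow> (s, t) \<in> (parcs G)\<^sup>*"
  unfolding le_flow_iff[OF assms(1)]
proof
  assume "\<exists>P. edge_disjoint_paths G s t P \<and> finite P \<and> card P = 1"
  then obtain p where "edge_disjoint_paths G s t {p}"
    by (auto simp: card_1_singleton_iff)
  then show "(s, t) \<in> (parcs G)\<^sup>*"
    by (auto simp: edge_disjoint_paths_iff rtrancl_iff_simple_path)
next
  assume "(s, t) \<in> (parcs G)\<^sup>*"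
  then obtain p where "simple_path s p t" "set p \<subseteq> parcs G"
    by (rule rtrancl_simple_path)
  then show "\<exists>P. edge_disjoint_paths G s t P \<and> finite P \<and> card P = 1"
    using assms by (intro exI[of _ "{p}"]) (auto simp: edge_disjoint_paths_iff)
qed

lemma flow_self:
  assumes "pair_digraph G" "s \<in> pverts G"
  shows "flow G s s = 1"
proof (rule antisym)
  show "1 \<le> flow G s s"
    using flow_pos_iff[of G s s] assms by simp
  obtain P where P: "edge_disjoint_paths G s s P" "card P = flow G s s"
    using le_flow_iff[OF assms(1)] by blast
  have "p = []" if "p \<in> P" for p
    using P(1) that simple_path_fst_neq_end[of s p s "hd p"]
    by (cases p) (auto simp: edge_disjoint_paths_iff)
  then have "P \<subseteq> {[]}"
    by blast
  then show "flow G s s \<le> 1"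
    using P(2) card_mono[of "{[]}" P] by simp
qed

lemma conn_commute: "conn G s t = conn G t s"
  by (simp add: conn_def min.commute)

lemma conn_triangle:
  assumes "pair_digraph G" "u \<in> pverts G" "v \<in> pverts G" "u \<noteq> v"
  shows "min (conn G s u) (conn G s v) \<le> conn G u v"
  using flow_triangle[of G u v s] flow_triangle[of G v u s] assms by (auto simp: conn_def)

lemma le_gconn_iff:
  "enat m \<le> gconn G \<longleftrightarrow> (\<forall>u\<in>pverts G. \<forall>v\<in>pverts G. u \<noteq> v \<longrightarrow> m \<le> conn G u v)"
  unfolding gconn_def le_Inf_iff by (simp add: Ball_def) (metis enat_ord_simps(1))

text \<open>Working with lower bounds \<open>m\<close> avoids evaluating the infimum, also when
  there are no two distinct vertices and only \<open>k\<close> remains.\<close>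

lemma le_gconn_upto_iff:
  "enat m \<le> gconn_upto k G \<longleftrightarrow>
     m \<le> k \<and> (\<forall>u\<in>pverts G. \<forall>v\<in>pverts G. u \<noteq> v \<longrightarrow> m \<le> conn G u v)"
  by (auto simp: gconn_upto_def le_gconn_iff)

text \<open>Up to \<open>k\<close> both graphs agree on the pairs with \<open>s\<close>, and
  \<open>conn_triangle\<close> carries those bounds to all other pairs. The form is one-sided so
  that swapping the graphs gives equality.\<close>

lemma gconn_upto_le:
  assumes "pair_digraph H" "s \<in> pverts H" "pverts H = pverts G"
    "\<And>t. t \<in> pverts G \<Longrightarrow> conn_upto k H s t = conn_upto k G s t"
  shows "gconn_upto k G \<le> gconn_upto k H"
proof -
  \<comment> \<open>Truncation at \<open>k\<close> rules out the value \<infinity>.\<close>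
  obtain m where m: "gconn_upto k G = enat m"
    by (cases "gconn_upto k G") (auto simp: gconn_upto_def min_def split: if_splits)
  have *: "m \<le> conn H s t" if "t \<in> pverts H" "t \<noteq> s" for t
  proof -
    have "m \<le> k" "m \<le> conn G s t"
      using that assms m le_gconn_upto_iff[of m k G] by auto
    then show ?thesis
      using assms(4)[of t] that assms(3) by (auto simp: conn_upto_def min_def split: if_splits)
  qed
  have "m \<le> conn H u v" if "u \<in> pverts H" "v \<in> pverts H" "u \<noteq> v" for u v
  proof (cases "u = s \<or> v = s")
    case True
    then show ?thesis
      using * that conn_commute by metis
  next
    case False
    then show ?thesis
      using *[of u] *[of v] conn_triangle[OF assms(1) that, of s] that by linarith
  qed
  moreover have "m \<le> k"
    using m le_gconn_upto_iff[of m k G] by simp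
  ultimately show ?thesis
    using m by (simp add: le_gconn_upto_iff)
qed

lemma gconn_upto_eq:
  assumes "pair_digraph H" "pair_digraph G" "pverts H = pverts G" "s \<in> pverts G"
    "\<And>t. t \<in> pverts G \<Longrightarrow> conn_upto k H s t = conn_upto k G s t"
  shows "gconn_upto k H = gconn_upto k G"
  using assms by (intro antisym gconn_upto_le[where s = s]) simp_all

section \<open>Spanning subgraphs\<close>

lemma pair_digraph_iff:
  "pair_digraph G \<longleftrightarrow> finite (pverts G) \<and> parcs G \<subseteq> pverts G \<times> pverts G \<and>
     (\<forall>e\<in>parcs G. fst e \<noteq> snd e)"
proof
  assume "pair_digraph G"
  then interpret pair_digraph G .
  show "finite (pverts G) \<and> parcs G \<subseteq> pverts G \<times> pverts G \<and> (\<forall>e\<in>parcs G. fst e \<noteq> snd e)"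
    using in_arcsD1 in_arcsD2 pair_no_loops pair_finite_verts by auto
next
  assume "finite (pverts G) \<and> parcs G \<subseteq> pverts G \<times> pverts G \<and> (\<forall>e\<in>parcs G. fst e \<noteq> snd e)"
  then show "pair_digraph G"
    by unfold_locales (auto simp: mem_Times_iff intro: finite_subset[OF _ finite_SigmaI])
qed

lemma spanning_with_proj_iff:
  assumes "pair_digraph G"
  shows "spanning (with_proj H) (with_proj G) \<longleftrightarrow> pverts H = pverts G \<and> parcs H \<subseteq> parcs G"
proof -
  interpret pair_digraph G by fact
  have "pair_wf_digraph H" if "pverts H = pverts G" "parcs H \<subseteq> parcs G"
    using that in_arcsD1 in_arcsD2 by unfold_locales auto
  then show ?thesis
    using pair_wf_digraph by (auto simp: spanning_def subgraph_def compatible_def wf_digraph_wp_iff)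
qed

lemma pair_digraph_spanning_subgraph:
  "pair_digraph G \<Longrightarrow> pverts H = pverts G \<Longrightarrow> parcs H \<subseteq> parcs G \<Longrightarrow> pair_digraph H"
  by (auto simp: pair_digraph_iff)

lemma del_edges_simps [simp]:
  "pverts (del_edges G F) = pverts G" "parcs (del_edges G F) = parcs G - F"
  by (simp_all add: del_edges_def)

lemma pair_digraph_del_edges: "pair_digraph G \<Longrightarrow> pair_digraph (del_edges G F)"
  by (rule pair_digraph_spanning_subgraph) auto

text \<open>Connectivity truncated at 1 records only mutual reachability, so the fault-tolerant
  family can be handled with reflexive transitive closures.\<close>

lemma conn_pos_iff:
  assumes "pair_digraph G" "s \<in> pverts G" "t \<in> pverts G"
  shows "1 \<le> conn G s t \<longleftrightarrow> (s, t) \<in> (parcs G)\<^sup>* \<and> (t, s) \<in> (parcs G)\<^sup>*"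
  using flow_pos_iff[OF assms(1)] assms by (simp add: conn_def)

section \<open>Preservers\<close>

lemma single_source_ft_imp_global_ft:
  assumes "pair_digraph G" "s \<in> pverts G" "single_source_ft_preserver k G s H"
  shows "global_ft_preserver k G H"
proof -
  have H: "pverts H = pverts G" "parcs H \<subseteq> parcs G"
    using assms by (auto simp: single_source_ft_preserver_def spanning_with_proj_iff)
  have "gconn_upto 1 (del_edges H F) = gconn_upto 1 (del_edges G F)"
    if "F \<subseteq> parcs G" "card F \<le> k" for F
    using that assms H pair_digraph_spanning_subgraph[OF assms(1) H]
    by (intro gconn_upto_eq[where s = s])
       (auto simp: pair_digraph_del_edges single_source_ft_preserver_def)
  then show ?thesis
    using assms by (auto simp: global_ft_preserver_def single_source_ft_preserver_def)
qed

lemma single_source_conn_imp_global_conn: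
  assumes "pair_digraph G" "s \<in> pverts G" "single_source_conn_preserver k G s H"
  shows "global_conn_preserver k G H"
proof -
  have H: "pverts H = pverts G" "parcs H \<subseteq> parcs G"
    using assms by (auto simp: single_source_conn_preserver_def spanning_with_proj_iff)
  have "gconn_upto k H = gconn_upto k G"
    using assms H pair_digraph_spanning_subgraph[OF assms(1) H]
    by (intro gconn_upto_eq[where s = s]) (auto simp: single_source_conn_preserver_def)
  then show ?thesis
    using assms by (auto simp: global_conn_preserver_def single_source_conn_preserver_def)
qed

section \<open>From global to \<open>s\<close>-\<open>t\<close> in the fault-tolerant family\<close>

text \<open>One direction only. \<open>B\<close> consists of the original arcs in a global preserver
  of the auxiliary digraph, which has the vertices of \<open>G\<close> and is therefore subject to
  the same bound \<open>c\<close>.\<close>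

lemma reachability_preserver_from_global_ft:
  assumes G: "pair_digraph G" and st: "s \<in> pverts G" "t \<in> pverts G" "s \<noteq> t"
    and glob: "\<And>G'. pair_digraph G' \<Longrightarrow> pverts G' = pverts G \<Longrightarrow>
      \<exists>H. global_ft_preserver k G' H \<and> real (card (parcs H)) \<le> c"
  shows "\<exists>B\<subseteq>parcs G. real (card B) \<le> c \<and>
    (\<forall>F. F \<subseteq> parcs G \<and> card F \<le> k \<longrightarrow> (s, t) \<in> (parcs G - F)\<^sup>* \<longrightarrow> (s, t) \<in> (B - F)\<^sup>*)"
proof -
  define V where "V = pverts G"
  define E0 where "E0 = {e \<in> parcs G. snd e \<noteq> s \<and> fst e \<noteq> t}"
  \<comment> \<open>No arc of \<open>E0\<close> enters \<open>s\<close> or leaves \<open>t\<close>,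
    so the union with the added arcs is disjoint and faults inside \<open>E0\<close> spare all added
    arcs.\<close>
  define G' where
    "G' = \<lparr>pverts = V, parcs = E0 \<union> (V - {s}) \<times> {s} \<union> {t} \<times> (V - {t})\<rparr>"
  have G': "pair_digraph G'" "pverts G' = V"
    using G st unfolding pair_digraph_iff G'_def V_def E0_def by auto
  from glob[OF G'(1)] obtain H where H: "global_ft_preserver k G' H" "real (card (parcs H)) \<le> c"
    using G'(2) V_def by auto
  have HV: "pverts H = V" "parcs H \<subseteq> parcs G'"
    using H(1) G' by (auto simp: global_ft_preserver_def spanning_with_proj_iff)
  have "pair_digraph H"
    using pair_digraph_spanning_subgraph[OF G'(1)] HV G'(2) by simp
  define B where "B = parcs H \<inter> E0"
  have "finite (parcs H)"
    using \<open>pair_digraph H\<close> by (simp add: pair_digraph_def pair_fin_digraph.pair_finite_arcs)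
  then have "card B \<le> card (parcs H)"
    by (intro card_mono) (auto simp: B_def)
  then have "real (card B) \<le> c"
    using H(2) by linarith
  moreover have "(s, t) \<in> (B - F)\<^sup>*"
    if F: "F \<subseteq> parcs G" "card F \<le> k" and reach: "(s, t) \<in> (parcs G - F)\<^sup>*" for F
  proof -
    \<comment> \<open>\<open>F\<close> may contain arcs of \<open>G\<close> into \<open>s\<close> or
      out of \<open>t\<close>, which reappear in \<open>G'\<close> as added arcs. Restricting the
      faults to \<open>E0\<close> keeps them intact.\<close>
    define F0 where "F0 = F \<inter> E0"
    have "finite F"
      using F(1) G by (meson finite_subset pair_digraph_def pair_fin_digraph.pair_finite_arcs)
    then have "card F0 \<le> k"
      using F(2) card_mono[of F F0] by (auto simp: F0_def)
    have F0: "F0 \<subseteq> parcs G'"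
      by (auto simp: F0_def G'_def)
    have "{e \<in> parcs G - F. snd e \<noteq> s \<and> fst e \<noteq> t} \<subseteq> parcs G' - F0"
      by (auto simp: F0_def G'_def E0_def)
    then have st_reach: "(s, t) \<in> (parcs G' - F0)\<^sup>*"
      using rtrancl_avoid_ends[OF reach] rtrancl_mono by blast
    have to_s: "(x, s) \<in> (parcs G' - F0)\<^sup>*" if "x \<in> V" for x
      using that by (cases "x = s") (auto simp: G'_def F0_def E0_def intro: r_into_rtrancl)
    have from_t: "(t, x) \<in> (parcs G' - F0)\<^sup>*" if "x \<in> V" for x
      using that by (cases "x = t") (auto simp: G'_def F0_def E0_def intro: r_into_rtrancl)
    \<comment> \<open>From \<open>x\<close> to \<open>s\<close> by at most one added arc, on to
      \<open>t\<close>, and to \<open>y\<close> by at most one added arc.\<close>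
    have "(x, y) \<in> (parcs G' - F0)\<^sup>*" if "x \<in> V" "y \<in> V" for x y
      using to_s[OF that(1)] st_reach from_t[OF that(2)] by (meson rtrancl_trans)
    then have "\<forall>x\<in>V. \<forall>y\<in>V. x \<noteq> y \<longrightarrow> 1 \<le> conn (del_edges G' F0) x y"
      using conn_pos_iff[OF pair_digraph_del_edges[OF G'(1)]] G'(2) by simp
    then have "enat 1 \<le> gconn_upto 1 (del_edges G' F0)"
      using G'(2) by (subst le_gconn_upto_iff) simp
    also have "\<dots> = gconn_upto 1 (del_edges H F0)"
      using H(1) F0 \<open>card F0 \<le> k\<close> by (simp add: global_ft_preserver_def)
    finally have "1 \<le> conn (del_edges H F0) s t"
      using st HV(1) by (subst (asm) le_gconn_upto_iff) (simp add: V_def)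
    then have "(s, t) \<in> (parcs H - F0)\<^sup>*"
      using conn_pos_iff[OF pair_digraph_del_edges[OF \<open>pair_digraph H\<close>]] st HV(1)
      by (simp add: V_def)
    \<comment> \<open>Back to \<open>G\<close>: the path can be chosen without added arcs, so it
      stays in \<open>B\<close>; on \<open>E0\<close> the sets \<open>F\<close> and
      \<open>F0\<close> coincide.\<close>
    then have "(s, t) \<in> {e \<in> parcs H - F0. snd e \<noteq> s \<and> fst e \<noteq> t}\<^sup>*"
      by (rule rtrancl_avoid_ends)
    moreover have "{e \<in> parcs H - F0. snd e \<noteq> s \<and> fst e \<noteq> t} \<subseteq> B - F"
      using HV(2) by (auto simp: B_def F0_def G'_def)
    ultimately show ?thesis
      using rtrancl_mono by blast
  qed
  ultimately show ?thesis
    by (intro exI[of _ B]) (auto simp: B_def E0_def)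
qed

text \<open>Connectivity is a minimum over both directions, so the arc sets for the two directions
  are united, at the cost of a factor 2.\<close>

lemma st_ft_preserver_from_global_ft:
  assumes G: "pair_digraph G" and st: "s \<in> pverts G" "t \<in> pverts G"
    and glob: "\<And>G'. pair_digraph G' \<Longrightarrow> pverts G' = pverts G \<Longrightarrow>
      \<exists>H. global_ft_preserver k G' H \<and> real (card (parcs H)) \<le> c"
  shows "\<exists>H. st_ft_preserver k G s t H \<and> real (card (parcs H)) \<le> 2 * \<bar>c\<bar>"
proof -
  have "\<exists>B\<subseteq>parcs G. real (card B) \<le> 2 * \<bar>c\<bar> \<and> (\<forall>F. F \<subseteq> parcs G \<and> card F \<le> k \<longrightarrow>
    ((s, t) \<in> (parcs G - F)\<^sup>* \<longrightarrow> (s, t) \<in> (B - F)\<^sup>*) \<and>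
    ((t, s) \<in> (parcs G - F)\<^sup>* \<longrightarrow> (t, s) \<in> (B - F)\<^sup>*))"
  proof (cases "s = t")
    case True
    \<comment> \<open>The empty path suffices here, and the absolute value puts 0 within the bound
      at once.\<close>
    then show ?thesis
      by (intro exI[of _ "{}"]) auto
  next
    case False
    obtain B1 where B1: "B1 \<subseteq> parcs G" "real (card B1) \<le> c"
      "\<And>F. F \<subseteq> parcs G \<and> card F \<le> k \<Longrightarrow> (s, t) \<in> (parcs G - F)\<^sup>* \<Longrightarrow> (s, t) \<in> (B1 - F)\<^sup>*"
      using reachability_preserver_from_global_ft[OF G st False glob] by blast
    obtain B2 where B2: "B2 \<subseteq> parcs G" "real (card B2) \<le> c"
      "\<And>F. F \<subseteq> parcs G \<and> card F \<le> k \<Longrightarrow> (t, s) \<in> (parcs G - F)\<^sup>* \<Longrightarrow> (t, s) \<in> (B2 - F)\<^sup>*"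
      using reachability_preserver_from_global_ft[OF G st(2,1) False[symmetric] glob] by blast
    have "real (card (B1 \<union> B2)) \<le> 2 * \<bar>c\<bar>"
      using card_Un_le[of B1 B2] B1(2) B2(2) by linarith
    moreover have "(B1 - F)\<^sup>* \<subseteq> (B1 \<union> B2 - F)\<^sup>*" "(B2 - F)\<^sup>* \<subseteq> (B1 \<union> B2 - F)\<^sup>*" for F
      by (auto intro!: rtrancl_mono)
    ultimately show ?thesis
      using B1 B2 by (intro exI[of _ "B1 \<union> B2"]) blast
  qed
  then obtain B where B: "B \<subseteq> parcs G" "real (card B) \<le> 2 * \<bar>c\<bar>"
    "\<And>F. F \<subseteq> parcs G \<and> card F \<le> k \<Longrightarrow>
      ((s, t) \<in> (parcs G - F)\<^sup>* \<longrightarrow> (s, t) \<in> (B - F)\<^sup>*) \<and>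
      ((t, s) \<in> (parcs G - F)\<^sup>* \<longrightarrow> (t, s) \<in> (B - F)\<^sup>*)"
    by blast
  define H where "H = \<lparr>pverts = pverts G, parcs = B\<rparr>"
  have H: "pair_digraph H"
    using pair_digraph_spanning_subgraph[OF G] B(1) by (simp add: H_def)
  have "conn_upto 1 (del_edges H F) s t = conn_upto 1 (del_edges G F) s t"
    if "F \<subseteq> parcs G \<and> card F \<le> k" for F
  proof -
    have "(B - F)\<^sup>* \<subseteq> (parcs G - F)\<^sup>*"
      using B(1) by (intro rtrancl_mono) auto
    then have "1 \<le> conn (del_edges H F) s t \<longleftrightarrow> 1 \<le> conn (del_edges G F) s t"
      using B(3)[OF that] conn_pos_iff[OF pair_digraph_del_edges[OF H]]
        conn_pos_iff[OF pair_digraph_del_edges[OF G]] st by (auto simp: H_def)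
    then show ?thesis
      by (auto simp: conn_upto_def min_def)
  qed
  then show ?thesis
    using B G by (intro exI[of _ H]) (auto simp: st_ft_preserver_def spanning_with_proj_iff H_def)
qed

section \<open>From global to \<open>s\<close>-\<open>t\<close> in the connectivity family\<close>

text \<open>There is a path with two arcs through each vertex other than \<open>u\<close> and
  \<open>v\<close>; the direct arc takes the index \<open>w = v\<close>.\<close>

lemma flow_complete:
  assumes "finite V" "u \<in> V" "v \<in> V" "u \<noteq> v"
  shows "card V - 1 \<le> flow \<lparr>pverts = V, parcs = {e \<in> V \<times> V. fst e \<noteq> snd e}\<rparr> u v"
    (is "_ \<le> flow ?K u v")
proof -
  define path where "path w = (if w = v then [(u, v)] else [(u, w), (w, v)])" for w
  have K: "pair_digraph ?K"
    using assms by (auto simp: pair_digraph_iff)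
  have "inj_on path (V - {u})"
    by (auto simp: inj_on_def path_def)
  then have "card (path ` (V - {u})) = card V - 1"
    using assms by (simp add: card_image)
  moreover have "edge_disjoint_paths ?K u v (path ` (V - {u}))"
    using assms by (auto simp: edge_disjoint_paths_iff path_def pairwise_def)
  ultimately show ?thesis
    using card_le_flow[OF K, of u v "path ` (V - {u})"] by simp
qed

lemma card_cut_singleton_le:
  assumes "pair_digraph G" "u \<in> pverts G"
  shows "card (cut_arcs (parcs G) {u}) \<le> card (pverts G) - 1"
proof -
  have "finite (pverts G)"
    using assms by (simp add: pair_digraph_iff)
  moreover have "cut_arcs (parcs G) {u} \<subseteq> Pair u ` (pverts G - {u})"
    using assms(1) by (auto simp: cut_arcs_def pair_digraph_iff)
  ultimately have "card (cut_arcs (parcs G) {u}) \<le> card (pverts G - {u})"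
    by (meson card_image_le card_mono finite_Diff finite_imageI le_trans)
  then show ?thesis
    using assms(2) \<open>finite (pverts G)\<close> by simp
qed

text \<open>Singleton cuts of \<open>H\<close> have at least \<open>min k (card V - 1)\<close> arcs
  each, and those of different vertices are disjoint.\<close>

lemma card_global_conn_preserver_complete:
  assumes "finite V" "2 \<le> card V"
    and "global_conn_preserver k \<lparr>pverts = V, parcs = {e \<in> V \<times> V. fst e \<noteq> snd e}\<rparr> H"
      (is "global_conn_preserver k ?K H")
  shows "card V * min k (card V - 1) \<le> card (parcs H)"
proof -
  define m where "m = min k (card V - 1)"
  have K: "pair_digraph ?K"
    using assms by (auto simp: pair_digraph_iff)
  have HV: "pverts H = V" "parcs H \<subseteq> parcs ?K"
    using assms(3) K by (auto simp: global_conn_preserver_def spanning_with_proj_iff)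
  have H: "pair_digraph H"
    using pair_digraph_spanning_subgraph[OF K] HV by simp
  have "enat m \<le> gconn_upto k ?K"
    using flow_complete[OF assms(1)] by (auto simp: le_gconn_upto_iff conn_def m_def min_le_iff_disj)
  then have "enat m \<le> gconn_upto k H"
    using assms(3) by (simp add: global_conn_preserver_def)
  then have conn: "m \<le> conn H x y" if "x \<in> V" "y \<in> V" "x \<noteq> y" for x y
    using that HV(1) by (simp add: le_gconn_upto_iff)
  have outdeg: "m \<le> card (cut_arcs (parcs H) {x})" if x: "x \<in> V" for x
  proof -
    \<comment> \<open>The cut around \<open>x\<close> needs a vertex on its other side; this is
      where \<open>2 \<le> card V\<close> enters.\<close>
    have "\<not> V \<subseteq> {x}"
      using assms(2) card_mono[of "{x}" V] by auto
    then obtain y where "y \<in> V" "y \<noteq> x"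
      by blast
    then show ?thesis
      using conn[OF x, of y] flow_le_cut[OF H, of x "{x}" y] by (auto simp: conn_def)
  qed
  have fin: "finite (parcs H)"
    using H by (simp add: pair_digraph_def pair_fin_digraph.pair_finite_arcs)
  have "card V * m = (\<Sum>x\<in>V. m)"
    by simp
  also have "\<dots> \<le> (\<Sum>x\<in>V. card (cut_arcs (parcs H) {x}))"
    using outdeg by (intro sum_mono)
  also have "\<dots> = card (\<Union>x\<in>V. cut_arcs (parcs H) {x})"
    using assms(1) fin by (intro card_UN_disjoint[symmetric]) (auto simp: cut_arcs_def)
  also have "\<dots> \<le> card (parcs H)"
    using fin by (intro card_mono) (auto simp: cut_arcs_def)
  finally show ?thesis
    by (simp add: m_def)
qed

text \<open>The bound is chosen to match the lower bound for the complete digraph: the second factor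
  bounds the number of paths, the first the arcs of each. Quantifying over all \<open>H\<close>
  above \<open>B\<close> lets the sets for both directions be united.\<close>

lemma flow_preserving_arcs:
  assumes G: "pair_digraph G" and st: "s \<in> pverts G" "t \<in> pverts G" "s \<noteq> t"
  shows "\<exists>B\<subseteq>parcs G. card B \<le> card (pverts G) * min k (card (pverts G) - 1) \<and>
    (\<forall>H. pair_digraph H \<and> pverts H = pverts G \<and> B \<subseteq> parcs H \<longrightarrow>
      min k (flow G s t) \<le> flow H s t)"
proof -
  obtain P where P: "edge_disjoint_paths G s t P" "finite P" "card P = min k (flow G s t)"
    using le_flow_iff[OF G] by (metis min.cobounded2)
  define B where "B = (\<Union>p\<in>P. set p)"
  \<comment> \<open>Disjoint paths leave \<open>s\<close> by different arcs, and the cut around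
    \<open>s\<close> has at most \<open>card (pverts G) - 1\<close> of them.\<close>
  have card_P: "card P \<le> min k (card (pverts G) - 1)"
    using P(3) flow_le_cut[OF G, of s "{s}" t] card_cut_singleton_le[OF G st(1)] st by auto
  have "card (set p) \<le> card (pverts G)" if "p \<in> P" for p
  proof -
    interpret pair_digraph G by fact
    have "apath s p t"
      using P(1) that by (simp add: edge_disjoint_paths_def)
    then show ?thesis
      using length_apath card_length le_trans by blast
  qed
  then have "(\<Sum>p\<in>P. card (set p)) \<le> card P * card (pverts G)"
    using sum_bounded_above[of P "\<lambda>p. card (set p)" "card (pverts G)"] by simp
  then have "card B \<le> card P * card (pverts G)"
    unfolding B_def using card_UN_le[OF P(2), of set] by linarith
  also have "\<dots> \<le> card (pverts G) * min k (card (pverts G) - 1)"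
    using card_P by (metis mult.commute mult_le_mono1)
  finally have "card B \<le> card (pverts G) * min k (card (pverts G) - 1)" .
  moreover have "min k (flow G s t) \<le> flow H s t"
    if "pair_digraph H" "pverts H = pverts G" "B \<subseteq> parcs H" for H
  proof -
    have "edge_disjoint_paths H s t P"
      using P(1) that by (auto simp: edge_disjoint_paths_iff B_def)
    then show ?thesis
      using card_le_flow[OF that(1)] P(3) by metis
  qed
  ultimately show ?thesis
    using P(1) by (intro exI[of _ B]) (auto simp: B_def edge_disjoint_paths_iff)
qed

text \<open>The hypothesis is applied to the complete digraph on the vertices of \<open>G\<close>,
  where it yields a lower bound on \<open>c\<close>; the preserver of \<open>G\<close> itself is
  assembled from paths.\<close>

lemma st_conn_preserver_from_global_conn:
  assumes G: "pair_digraph G" and st: "s \<in> pverts G" "t \<in> pverts G"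
    and glob: "\<And>G'. pair_digraph G' \<Longrightarrow> pverts G' = pverts G \<Longrightarrow>
      \<exists>H. global_conn_preserver k G' H \<and> real (card (parcs H)) \<le> c"
  shows "\<exists>H. st_conn_preserver k G s t H \<and> real (card (parcs H)) \<le> 2 * \<bar>c\<bar>"
proof -
  have "\<exists>B\<subseteq>parcs G. real (card B) \<le> 2 * \<bar>c\<bar> \<and>
    (\<forall>H. pair_digraph H \<and> pverts H = pverts G \<and> B \<subseteq> parcs H \<longrightarrow>
      min k (flow G s t) \<le> flow H s t \<and> min k (flow G t s) \<le> flow H t s)"
  proof (cases "s = t")
    case True
    show ?thesis
      using True st G by (intro exI[of _ "{}"]) (auto simp: flow_self)
  next
    case False
    define V where "V = pverts G"
    have fin: "finite V"
      using G by (simp add: V_def pair_digraph_iff)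
    have "card {s, t} \<le> card V"
      using st fin by (intro card_mono) (auto simp: V_def)
    then have "2 \<le> card V"
      using False by simp
    obtain H where "global_conn_preserver k \<lparr>pverts = V, parcs = {e \<in> V \<times> V. fst e \<noteq> snd e}\<rparr> H"
      "real (card (parcs H)) \<le> c"
      using glob[of "\<lparr>pverts = V, parcs = {e \<in> V \<times> V. fst e \<noteq> snd e}\<rparr>"] fin
      by (auto simp: pair_digraph_iff V_def)
    then have c: "real (card V * min k (card V - 1)) \<le> c"
      using card_global_conn_preserver_complete[OF fin \<open>2 \<le> card V\<close>]
      by (meson of_nat_mono order_trans)
    obtain B1 where B1: "B1 \<subseteq> parcs G" "card B1 \<le> card V * min k (card V - 1)"
      "\<And>H. pair_digraph H \<and> pverts H = pverts G \<and> B1 \<subseteq> parcs H \<Longrightarrow>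
        min k (flow G s t) \<le> flow H s t"
      using flow_preserving_arcs[OF G st False, of k] unfolding V_def by blast
    obtain B2 where B2: "B2 \<subseteq> parcs G" "card B2 \<le> card V * min k (card V - 1)"
      "\<And>H. pair_digraph H \<and> pverts H = pverts G \<and> B2 \<subseteq> parcs H \<Longrightarrow>
        min k (flow G t s) \<le> flow H t s"
      using flow_preserving_arcs[OF G st(2,1) False[symmetric], of k] unfolding V_def by blast
    have "card (B1 \<union> B2) \<le> 2 * (card V * min k (card V - 1))"
      using card_Un_le[of B1 B2] B1(2) B2(2) by linarith
    then have "real (card (B1 \<union> B2)) \<le> real (2 * (card V * min k (card V - 1)))"
      by (rule of_nat_mono)
    then have "real (card (B1 \<union> B2)) \<le> 2 * \<bar>c\<bar>"
      using c by simp
    then show ?thesis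
      using B1 B2 by (intro exI[of _ "B1 \<union> B2"]) auto
  qed
  then obtain B where B: "B \<subseteq> parcs G" "real (card B) \<le> 2 * \<bar>c\<bar>"
    "\<And>H. pair_digraph H \<and> pverts H = pverts G \<and> B \<subseteq> parcs H \<Longrightarrow>
      min k (flow G s t) \<le> flow H s t \<and> min k (flow G t s) \<le> flow H t s"
    by blast
  define H where "H = \<lparr>pverts = pverts G, parcs = B\<rparr>"
  have H: "pair_digraph H"
    using pair_digraph_spanning_subgraph[OF G] B(1) by (simp add: H_def)
  have "flow H s t \<le> flow G s t" "flow H t s \<le> flow G t s"
    using B(1) by (intro flow_mono H G; simp add: H_def)+
  moreover have "min k (flow G s t) \<le> flow H s t \<and> min k (flow G t s) \<le> flow H t s"
    using B(3)[of H] H by (simp add: H_def)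
  ultimately have "conn_upto k H s t = conn_upto k G s t"
    unfolding conn_upto_def conn_def by linarith
  then show ?thesis
    using B G by (intro exI[of _ H]) (auto simp: st_conn_preserver_def spanning_with_proj_iff H_def)
qed

text \<open>Covers the digraph without vertices, for which the single-source hypothesis offers no
  source to start from.\<close>

lemma empty_global_preservers:
  assumes "pair_digraph G" "pverts G = {}"
  shows "global_ft_preserver k G G" "global_conn_preserver k G G" "parcs G = {}"
  using assms by (auto simp: global_ft_preserver_def global_conn_preserver_def
      spanning_with_proj_iff pair_digraph_iff)

theorem theoremA4:
  "\<exists>C :: real. C > 0 \<and>
     (\<forall>(k :: nat) (f :: nat \<Rightarrow> nat \<Rightarrow> real). k \<ge> 1 \<longrightarrow>
         ((\<forall>n. \<forall>G :: 'a pair_pre_digraph. n_vertex_digraph n G \<longrightarrow>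
            (\<exists>H. global_ft_preserver k G H \<and> real (card (parcs H)) \<le> f n k))
          \<longrightarrow>
          (\<forall>n. \<forall>G :: 'a pair_pre_digraph. n_vertex_digraph n G \<longrightarrow>
            (\<forall>s\<in>pverts G. \<forall>t\<in>pverts G. \<exists>H. st_ft_preserver k G s t H \<and> real (card (parcs H)) \<le> C * \<bar>f n k\<bar>))) \<and>
         ((\<forall>n. \<forall>G :: 'a pair_pre_digraph. n_vertex_digraph n G \<longrightarrow>
            (\<forall>s\<in>pverts G. \<exists>H. single_source_ft_preserver k G s H \<and> real (card (parcs H)) \<le> f n k))
          \<longrightarrow>
          (\<forall>n. \<forall>G :: 'a pair_pre_digraph. n_vertex_digraph n G \<longrightarrow>
            (\<exists>H. global_ft_preserver k G H \<and> real (card (parcs H)) \<le> C * \<bar>f n k\<bar>))) \<and>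
         ((\<forall>n. \<forall>G :: 'a pair_pre_digraph. n_vertex_digraph n G \<longrightarrow>
            (\<exists>H. all_pairs_ft_preserver k G H \<and> real (card (parcs H)) \<le> f n k))
          \<longrightarrow>
          (\<forall>n. \<forall>G :: 'a pair_pre_digraph. n_vertex_digraph n G \<longrightarrow>
            (\<forall>s\<in>pverts G. \<exists>H. single_source_ft_preserver k G s H \<and> real (card (parcs H)) \<le> C * \<bar>f n k\<bar>))) \<and>
         ((\<forall>n. \<forall>G :: 'a pair_pre_digraph. n_vertex_digraph n G \<longrightarrow>
            (\<exists>H. global_conn_preserver k G H \<and> real (card (parcs H)) \<le> f n k))
          \<longrightarrow>
          (\<forall>n. \<forall>G :: 'a pair_pre_digraph. n_vertex_digraph n G \<longrightarrow>
            (\<forall>s\<in>pverts G. \<forall>t\<in>pverts G. \<exists>H. st_conn_preserver k G s t H \<and> real (card (parcs H)) \<le> C * \<bar>f n k\<bar>))) \<and>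
         ((\<forall>n. \<forall>G :: 'a pair_pre_digraph. n_vertex_digraph n G \<longrightarrow>
            (\<forall>s\<in>pverts G. \<exists>H. single_source_conn_preserver k G s H \<and> real (card (parcs H)) \<le> f n k))
          \<longrightarrow>
          (\<forall>n. \<forall>G :: 'a pair_pre_digraph. n_vertex_digraph n G \<longrightarrow>
            (\<exists>H. global_conn_preserver k G H \<and> real (card (parcs H)) \<le> C * \<bar>f n k\<bar>))) \<and>
         ((\<forall>n. \<forall>G :: 'a pair_pre_digraph. n_vertex_digraph n G \<longrightarrow>
            (\<exists>H. all_pairs_conn_preserver k G H \<and> real (card (parcs H)) \<le> f n k))
          \<longrightarrow>
          (\<forall>n. \<forall>G :: 'a pair_pre_digraph. n_vertex_digraph n G \<longrightarrow>
            (\<forall>s\<in>pverts G. \<exists>H. single_source_conn_preserver k G s H \<and> real (card (parcs H)) \<le> C * \<bar>f n k\<bar>))))"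
proof (intro exI[of _ 2] conjI allI impI ballI, goal_cases)
  \<comment> \<open>The witness 2 reflects the two directions in the
    \<open>s\<close>-\<open>t\<close> cases; the other cases meet the bound with factor 1. Goal 1,
    its positivity, is left to the closing \<open>simp\<close>.\<close>
  case (2 k f n G s t)
  then have G: "pair_digraph G" "n_vertex_digraph n G' \<longleftrightarrow> pair_digraph G'"
    if "pverts G' = pverts G" for G'
    using that by (simp_all add: n_vertex_digraph_def)
  show ?case
  proof (rule st_ft_preserver_from_global_ft)
    show "\<exists>H. global_ft_preserver k G' H \<and> real (card (parcs H)) \<le> f n k"
      if "pair_digraph G'" "pverts G' = pverts G" for G'
      using 2(2) G(2)[OF that(2)] that(1) by blast
  qed (use 2 G in auto)
next
  case (3 k f n G)
  then have G: "pair_digraph G"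
    by (simp add: n_vertex_digraph_def)
  show ?case
  proof (cases "pverts G = {}")
    case True
    then show ?thesis
      using empty_global_preservers[OF G] by (intro exI[of _ G]) auto
  next
    case False
    then obtain s where s: "s \<in> pverts G"
      by blast
    then obtain H where "single_source_ft_preserver k G s H" "real (card (parcs H)) \<le> f n k"
      using 3 by blast
    then show ?thesis
      using single_source_ft_imp_global_ft[OF G s] by (intro exI[of _ H]) auto
  qed
next
  case (4 k f n G s)
  then obtain H where "all_pairs_ft_preserver k G H" "real (card (parcs H)) \<le> f n k"
    by blast
  then show ?case
    using 4 by (intro exI[of _ H])
      (auto simp: all_pairs_ft_preserver_def single_source_ft_preserver_def)
next
  case (5 k f n G s t)
  then have G: "pair_digraph G" "n_vertex_digraph n G' \<longleftrightarrow> pair_digraph G'"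
    if "pverts G' = pverts G" for G'
    using that by (simp_all add: n_vertex_digraph_def)
  show ?case
  proof (rule st_conn_preserver_from_global_conn)
    show "\<exists>H. global_conn_preserver k G' H \<and> real (card (parcs H)) \<le> f n k"
      if "pair_digraph G'" "pverts G' = pverts G" for G'
      using 5(2) G(2)[OF that(2)] that(1) by blast
  qed (use 5 G in auto)
next
  case (6 k f n G)
  then have G: "pair_digraph G"
    by (simp add: n_vertex_digraph_def)
  show ?case
  proof (cases "pverts G = {}")
    case True
    then show ?thesis
      using empty_global_preservers[OF G] by (intro exI[of _ G]) auto
  next
    case False
    then obtain s where s: "s \<in> pverts G"
      by blast
    then obtain H where "single_source_conn_preserver k G s H" "real (card (parcs H)) \<le> f n k"
      using 6 by blast
    then show ?thesis
      using single_source_conn_imp_global_conn[OF G s] by (intro exI[of _ H]) auto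
  qed
next
  case (7 k f n G s)
  then obtain H where "all_pairs_conn_preserver k G H" "real (card (parcs H)) \<le> f n k"
    by blast
  then show ?case
    using 7 by (intro exI[of _ H])
      (auto simp: all_pairs_conn_preserver_def single_source_conn_preserver_def)
qed simp

end
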